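(* Let $1\le n_0\le n$ be integers. Let $\mathcal F_{n_0,n}^{\to}$ be the set of all families $\{A_{u,v},d_v,\gamma_{u,v}\}_{u,v\in[n]}$ with $A_{u,v},\gamma_{u,v}\in\{0,1\}$ and $d_v\in\{0,1,\dots,n\}$ that satisfy the constraint system (S) with parameters $n_0,n$ given in the context. Let $\mathcal G_{n_0,n}^{\to}$ be the set of all labeled directed graphs whose number of nodes $m$ satisfies $n_0\le m\le n$ (the node set being $\{0,1,\dots,m-1\}$) and in which node $0$ can reach every node. Then there is a bijection between $\mathcal F_{n_0,n}^{\to}$ and $\mathcal G_{n_0,n}^{\to}$.
   Context: Notation: $[n]=\{0,1,\dots,n-1\}$. Graphs are directed, without self-loops or multiple edges. Node $u$ can reach node $v$ if there is a directed path (possibly of length $0$) from $u$ to $v$. The variable $A_{v,v}$ encodes whether node $v$ exists, and $A_{u,v}$ ($u\ne v$) whether the edge $u\to v$ exists. Constraint system (S) with parameters $n_0,n$: 1. $\sum_{v\in[n]}A_{v,v}\ge n_0$, and $A_{v,v}\ge A_{v+1,v+1}$ for all $v\in[n-1]$; 2. $2A_{u,v}\le A_{u,u}+A_{v,v}$ and $A_{u,v}\ge\gamma_{u,v}$ for all $u,v\in[n]$, $u\neq v$; 3. $\sum_{u\in[n]}\gamma_{u,0}=0$, and for all $v\in[n]\setminus\{0\}$: $\gamma_{v,v}=0$ and $A_{v,v}\le\sum_{u\in[n]}\gamma_{u,v}\le(n-1)A_{v,v}$; 4. $d_0=0$, and $1+(n-1)(1-A_{v,v})\le d_v\le n-A_{v,v}$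 for all $v\in[n]\setminus\{0\}$; 5. $(1-\gamma_{u,v})-n(1-A_{u,v})\le d_u+1-d_v\le(n+1)(1-\gamma_{u,v})$ for all $u,v\in[n]$, $u\neq v$. *)

theory Defs
  imports "HOL-Library.FuncSet" "Graph_Theory.Pair_Digraph"
begin

text \<open>All variables take integer values, so that subtraction in the constraints is not truncated.\<close>

definition constraint_system ::
  "nat \<Rightarrow> nat \<Rightarrow> (nat \<Rightarrow> nat \<Rightarrow> int) \<Rightarrow> (nat \<Rightarrow> int) \<Rightarrow> (nat \<Rightarrow> nat \<Rightarrow> int) \<Rightarrow> bool" where
  "constraint_system n0 n A d \<gamma> \<longleftrightarrow>
     (\<Sum>v\<in>{0..<n}. A v v) \<ge> int n0 \<and>
     (\<forall>v\<in>{0..<n - 1}. A v v \<ge> A (v + 1) (v + 1)) \<and>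
     (\<forall>u\<in>{0..<n}. \<forall>v\<in>{0..<n}. u \<noteq> v \<longrightarrow>
        2 * A u v \<le> A u u + A v v \<and> A u v \<ge> \<gamma> u v) \<and>
     (\<Sum>u\<in>{0..<n}. \<gamma> u 0) = 0 \<and>
     (\<forall>v\<in>{0..<n} - {0}.
        \<gamma> v v = 0 \<and>
        A v v \<le> (\<Sum>u\<in>{0..<n}. \<gamma> u v) \<and>
        (\<Sum>u\<in>{0..<n}. \<gamma> u v) \<le> (int n - 1) * A v v) \<and>
     d 0 = 0 \<and>
     (\<forall>v\<in>{0..<n} - {0}.
        1 + (int n - 1) * (1 - A v v) \<le> d v \<and> d v \<le> int n - A v v) \<and>
     (\<forall>u\<in>{0..<n}. \<forall>v\<in>{0..<n}. u \<noteq> v \<longrightarrow>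
        (1 - \<gamma> u v) - int n * (1 - A u v) \<le> d u + 1 - d v \<and>
        d u + 1 - d v \<le> (int n + 1) * (1 - \<gamma> u v))"

text \<open>Families indexed by \<open>{0..<n}\<close> are extensional functions, so that distinct members of the set
  below differ at some index in \<open>{0..<n}\<close>.\<close>

definition feasible_families ::
  "nat \<Rightarrow> nat \<Rightarrow> ((nat \<Rightarrow> nat \<Rightarrow> int) \<times> (nat \<Rightarrow> int) \<times> (nat \<Rightarrow> nat \<Rightarrow> int)) set" where
  "feasible_families n0 n =
     {(A, d, \<gamma>).
        A \<in> {0..<n} \<rightarrow>\<^sub>E ({0..<n} \<rightarrow>\<^sub>E {0, 1}) \<and>
        d \<in> {0..<n} \<rightarrow>\<^sub>E {0..int n} \<and>
        \<gamma> \<in> {0..<n} \<rightarrow>\<^sub>E ({0..<n} \<rightarrow>\<^sub>E {0, 1}) \<and>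
        constraint_system n0 n A d \<gamma>}"

text \<open>\<open>pair_digraph\<close> is the locale of finite loop-free digraphs whose arcs are pairs of nodes, hence
  without multiple arcs; equality of two such graphs is equality as labeled graphs.\<close>

definition rooted_digraphs :: "nat \<Rightarrow> nat \<Rightarrow> nat pair_pre_digraph set" where
  "rooted_digraphs n0 n =
     {G. pair_digraph G \<and>
         (\<exists>m. n0 \<le> m \<and> m \<le> n \<and> pverts G = {0..<m}) \<and>
         (\<forall>v\<in>pverts G. 0 \<rightarrow>\<^sup>*\<^bsub>with_proj G\<^esub> v)}"

end

theory Submission
  imports Defs
begin

text \<open>
  A family \<open>(A, d, \<gamma>)\<close> satisfying the constraints is a graph together with redundant data that
  the graph determines. \<open>A\<close> lists the nodes on its
  diagonal and the arcs off it. On an arc \<open>u \<rightarrow> v\<close> the last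
  constraint says \<open>d v \<le> d u + 1\<close>, with equality exactly when \<open>\<gamma> u v = 1\<close>; the third one gives
  every existing node other than \<open>0\<close> an arc with \<open>\<gamma> u v = 1\<close> entering it. The first property bounds
  \<open>d v\<close> from above by the length of every path from \<open>0\<close> to \<open>v\<close>; following the arcs of the second
  one backwards yields a path of length exactly \<open>d v\<close>. Hence every existing node is reachable from
  \<open>0\<close> and \<open>d\<close> is the distance from \<open>0\<close> (\<open>hop_dist_unique\<close>); then \<open>\<gamma>\<close> marks the arcs between
  consecutive distance levels. At a missing node the bounds on \<open>d\<close> leave only the value \<open>n\<close>. So
  \<open>A\<close> determines the family.

  Conversely, for a graph in which \<open>0\<close> reaches every node, the distances and the arcs between
  consecutive levels satisfy the constraints. The upper bound \<open>d v \<le> n - 1\<close> at existing nodes holds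
  because each level up to that of \<open>v\<close> contains a node (\<open>hop_dist_less_card\<close>). The
  inequalities between \<open>d u\<close> and \<open>d v\<close> carry slack terms of order \<open>n\<close>, which make them void unless
  \<open>u \<rightarrow> v\<close> is an arc, respectively unless \<open>\<gamma> u v = 1\<close>.
\<close>

section \<open>Distance from a root\<close>

text \<open>Where no path exists, the value is an unspecified number; a node counts as reachable through
  membership in the reflexive-transitive closure.\<close>

definition hop_dist :: "'a \<Rightarrow> 'a rel \<Rightarrow> 'a \<Rightarrow> nat" where
  "hop_dist r E v = (LEAST k. (r, v) \<in> E ^^ k)"

lemma hop_dist_le: "(r, v) \<in> E ^^ k \<Longrightarrow> hop_dist r E v \<le> k"
  unfolding hop_dist_def by (rule Least_le)

lemma hop_dist_path: "(r, v) \<in> E\<^sup>* \<Longrightarrow> (r, v) \<in> E ^^ hop_dist r E v"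
  unfolding hop_dist_def by (meson LeastI rtrancl_imp_relpow)

lemma hop_dist_root [simp]: "hop_dist r E r = 0"
  using hop_dist_le[OF relpow_0_I[of r E]] by simp

lemma hop_dist_arc:
  assumes "(r, u) \<in> E\<^sup>*" "(u, v) \<in> E"
  shows "hop_dist r E v \<le> hop_dist r E u + 1"
  using hop_dist_le[OF relpow_Suc_I[OF hop_dist_path[OF assms(1)] assms(2)]] by simp

lemma hop_dist_predecessor:
  assumes "(r, v) \<in> E\<^sup>*" "v \<noteq> r"
  obtains u where "(r, u) \<in> E\<^sup>*" "(u, v) \<in> E" "hop_dist r E v = hop_dist r E u + 1"
proof -
  obtain k where k: "hop_dist r E v = Suc k"
    using hop_dist_path[OF assms(1)] assms(2) by (cases "hop_dist r E v") auto
  then obtain u where u: "(r, u) \<in> E ^^ k" "(u, v) \<in> E"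
    using hop_dist_path[OF assms(1)] by (auto elim: relpow_Suc_E)
  have reach: "(r, u) \<in> E\<^sup>*"
    using u(1) by (rule relpow_imp_rtrancl)
  have "hop_dist r E v = hop_dist r E u + 1"
    using hop_dist_le[OF u(1)] hop_dist_arc[OF reach u(2)] k by simp
  with reach u(2) show thesis by (rule that)
qed

text \<open>A shortest path meets every level on its way, so no level up to that of its end is empty.\<close>

lemma hop_dist_levels_nonempty:
  assumes "(r, v) \<in> E\<^sup>*" "j \<le> hop_dist r E v"
  shows "\<exists>w. (r, w) \<in> E\<^sup>* \<and> hop_dist r E w = j"
  using assms
proof (induction "hop_dist r E v" arbitrary: v)
  case 0
  then show ?case by auto
next
  case (Suc k)
  show ?case
  proof (cases "j = Suc k")
    case True
    with Suc show ?thesis by auto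
  next
    case False
    have "v \<noteq> r" using Suc.hyps(2) by auto
    then obtain u where "(r, u) \<in> E\<^sup>*" "hop_dist r E v = hop_dist r E u + 1"
      using hop_dist_predecessor[OF Suc.prems(1)] by blast
    with Suc False show ?thesis by simp
  qed
qed

text \<open>The levels up to that of \<open>v\<close> are disjoint nonempty sets of nodes, so there are at most as many
  of them as nodes.\<close>

lemma hop_dist_less_card:
  assumes "finite V" "r \<in> V" "E \<subseteq> V \<times> V" "(r, v) \<in> E\<^sup>*"
  shows "hop_dist r E v < card V"
proof -
  have V: "w \<in> V" if "(r, w) \<in> E\<^sup>*" for w
    using that assms(2,3) by (induction rule: rtrancl_induct) auto
  have "{..hop_dist r E v} \<subseteq> hop_dist r E ` V"
  proof
    fix j assume "j \<in> {..hop_dist r E v}"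
    then show "j \<in> hop_dist r E ` V"
      using hop_dist_levels_nonempty[OF assms(4), of j] V by auto
  qed
  then have "card {..hop_dist r E v} \<le> card V"
    by (meson assms(1) card_image_le card_mono finite_imageI le_trans)
  then show ?thesis by simp
qed

text \<open>Take a potential that is \<open>0\<close> at the root. If it grows by at most \<open>1\<close> along arcs, it is at most
  the length of any path. If it is nonnegative and can be descended in unit steps from every node
  but the root, then a descent ends at the root, and read backwards it is a path whose length is
  the potential.\<close>

lemma hop_dist_unique:
  fixes d :: "'a \<Rightarrow> int"
  assumes root: "d r = 0"
    and nonneg: "\<And>v. v \<in> V \<Longrightarrow> 0 \<le> d v"
    and arc: "\<And>u v. (u, v) \<in> E \<Longrightarrow> d v \<le> d u + 1"
    and descent: "\<And>v. v \<in> V \<Longrightarrow> v \<noteq> r \<Longrightarrow> \<exists>u\<in>V. (u, v) \<in> E \<and> d v = d u + 1"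
    and v: "v \<in> V"
  shows "(r, v) \<in> E\<^sup>*" "d v = int (hop_dist r E v)"
proof -
  have upper: "d w \<le> int k" if "(r, w) \<in> E ^^ k" for w k
    using that
  proof (induction k arbitrary: w)
    case 0
    then show ?case using root by simp
  next
    case (Suc k)
    then obtain u where "(r, u) \<in> E ^^ k" "(u, w) \<in> E" by (auto elim: relpow_Suc_E)
    with Suc.IH[of u] arc[of u w] show ?case by simp
  qed
  have path: "(r, w) \<in> E ^^ k" if "w \<in> V" "d w = int k" for w k
    using that
  proof (induction k arbitrary: w)
    case 0
    have "w = r"
    proof (rule ccontr)
      assume "w \<noteq> r"
      with descent 0 obtain u where "u \<in> V" "d w = d u + 1" by blast
      with nonneg[of u] 0 show False by simp
    qed
    then show ?case by simp
  next
    case (Suc k)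
    have "w \<noteq> r" using root Suc.prems(2) by auto
    with descent Suc.prems(1) obtain u where u: "u \<in> V" "(u, w) \<in> E" "d w = d u + 1" by blast
    with Suc.IH[of u] Suc.prems(2) have "(r, u) \<in> E ^^ k" by simp
    then show ?case using u(2) by (rule relpow_Suc_I)
  qed
  have "(r, v) \<in> E ^^ nat (d v)"
    using path[OF v] nonneg[OF v] by simp
  then have "hop_dist r E v \<le> nat (d v)" and reach: "(r, v) \<in> E\<^sup>*"
    by (auto intro: hop_dist_le relpow_imp_rtrancl)
  moreover have "d v \<le> int (hop_dist r E v)"
    using upper[OF hop_dist_path[OF reach]] .
  ultimately show "(r, v) \<in> E\<^sup>*" and "d v = int (hop_dist r E v)"
    using nonneg[OF v] by simp_all
qed

section \<open>Digraphs on initial segments\<close>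

text \<open>Arcs have both ends in the vertex set, so a path to a vertex never leaves it, and reachability
  inside the graph is the plain reflexive-transitive closure of the arcs.\<close>

lemma rooted_digraphs_iff:
  "G \<in> rooted_digraphs n0 n \<longleftrightarrow>
     (\<exists>m. n0 \<le> m \<and> m \<le> n \<and> pverts G = {0..<m}) \<and>
     parcs G \<subseteq> pverts G \<times> pverts G \<and> (\<forall>v. (v, v) \<notin> parcs G) \<and>
     (\<forall>v\<in>pverts G. (0, v) \<in> (parcs G)\<^sup>*)"
  (is "_ \<longleftrightarrow> ?segment \<and> ?wf \<and> ?loopfree \<and> ?reach")
proof -
  have pair_digraph: "pair_digraph G \<longleftrightarrow> ?wf \<and> ?loopfree" if "finite (pverts G)"
  proof
    assume "pair_digraph G"
    then interpret pair_digraph G .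
    show "?wf \<and> ?loopfree"
      using arc_fst_in_verts arc_snd_in_verts pair_no_loops by fastforce
  next
    assume "?wf \<and> ?loopfree"
    moreover from this have "finite (parcs G)"
      using that by (meson finite_SigmaI finite_subset)
    ultimately show "pair_digraph G"
      using that by unfold_locales auto
  qed
  have reachable: "0 \<rightarrow>\<^sup>*\<^bsub>with_proj G\<^esub> v \<longleftrightarrow> (0, v) \<in> (parcs G)\<^sup>*"
    if wf: ?wf and v: "v \<in> pverts G" for v
  proof
    assume "0 \<rightarrow>\<^sup>*\<^bsub>with_proj G\<^esub> v"
    then show "(0, v) \<in> (parcs G)\<^sup>*"
      by (auto simp: reachable_def dest: rtrancl_on_rtranclI)
  next
    assume "(0, v) \<in> (parcs G)\<^sup>*"
    then show "0 \<rightarrow>\<^sup>*\<^bsub>with_proj G\<^esub> v"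
      using v
    proof (induction rule: converse_rtrancl_induct)
      case base
      then show ?case by (auto simp: reachable_def)
    next
      case (step y z)
      with wf show ?case
        by (auto simp: reachable_def intro: converse_rtrancl_on_into_rtrancl_on)
    qed
  qed
  show ?thesis
  proof (cases "finite (pverts G)")
    case True
    with pair_digraph reachable show ?thesis
      unfolding rooted_digraphs_def by auto
  next
    case False
    then show ?thesis
      unfolding rooted_digraphs_def by auto
  qed
qed

lemma down_closed_eq_segment:
  fixes V :: "nat set"
  assumes "finite V" "\<And>u v. v \<in> V \<Longrightarrow> u < v \<Longrightarrow> u \<in> V"
  shows "V = {0..<card V}"
proof -
  define m where "m = (LEAST m. m \<notin> V)"
  have "m \<notin> V"
    unfolding m_def using assms(1) by (metis LeastI ex_new_if_finite infinite_UNIV_nat)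
  moreover have "u \<in> V" if "u < m" for u
    using not_less_Least that unfolding m_def by blast
  ultimately have "V = {0..<m}"
    using assms(2) by (auto simp: not_le[symmetric]) (metis le_neq_implies_less not_le)
  then show ?thesis by simp
qed

section \<open>From families to graphs\<close>

definition family_graph ::
  "nat \<Rightarrow> (nat \<Rightarrow> nat \<Rightarrow> int) \<times> (nat \<Rightarrow> int) \<times> (nat \<Rightarrow> nat \<Rightarrow> int) \<Rightarrow> nat pair_pre_digraph" where
  "family_graph n = (\<lambda>(A, d, \<gamma>).
     \<lparr>pverts = {v. v < n \<and> A v v = 1},
      parcs = {(u, v). u < n \<and> v < n \<and> u \<noteq> v \<and> A u v = 1}\<rparr>)"

lemma feasible_family_range:
  assumes "(A, d, \<gamma>) \<in> feasible_families n0 n" "u < n" "v < n"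
  shows "A u v = 0 \<or> A u v = 1" "\<gamma> u v = 0 \<or> \<gamma> u v = 1" "0 \<le> d v" "d v \<le> int n"
proof -
  have A: "A \<in> {0..<n} \<rightarrow>\<^sub>E ({0..<n} \<rightarrow>\<^sub>E {0, 1})"
    and \<gamma>: "\<gamma> \<in> {0..<n} \<rightarrow>\<^sub>E ({0..<n} \<rightarrow>\<^sub>E {0, 1})"
    and d: "d \<in> {0..<n} \<rightarrow>\<^sub>E {0..int n}"
    using assms(1) by (auto simp: feasible_families_def)
  have u: "u \<in> {0..<n}" and v: "v \<in> {0..<n}" using assms by auto
  show "A u v = 0 \<or> A u v = 1" using PiE_mem[OF PiE_mem[OF A u] v] by simp
  show "\<gamma> u v = 0 \<or> \<gamma> u v = 1" using PiE_mem[OF PiE_mem[OF \<gamma> u] v] by simp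
  show "0 \<le> d v" "d v \<le> int n" using PiE_mem[OF d v] by simp_all
qed

text \<open>Everything that the constraints say about \<open>d\<close> and \<open>\<gamma>\<close>, in terms of the graph encoded
  by \<open>A\<close>. The graph is a function of \<open>A\<close> alone, so the conclusions on \<open>d\<close> and \<open>\<gamma>\<close> show that they
  carry no further information.\<close>

lemma feasible_family_graph:
  assumes F: "(A, d, \<gamma>) \<in> feasible_families n0 n" and n0: "1 \<le> n0"
  defines "V \<equiv> pverts (family_graph n (A, d, \<gamma>))"
    and "E \<equiv> parcs (family_graph n (A, d, \<gamma>))"
  shows family_verts: "V = {0..<card V}" "n0 \<le> card V" "card V \<le> n"
    and family_arcs: "E \<subseteq> V \<times> V"
    and family_reach: "v \<in> V \<Longrightarrow> (0, v) \<in> E\<^sup>*"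
    and family_dist: "v \<in> V \<Longrightarrow> d v = int (hop_dist 0 E v)"
    and family_dist_missing: "v < n \<Longrightarrow> v \<notin> V \<Longrightarrow> d v = int n"
    and family_tight: "u < n \<Longrightarrow> v < n \<Longrightarrow> \<gamma> u v = 1 \<longleftrightarrow> (u, v) \<in> E \<and> d v = d u + 1"
proof -
  have V: "w \<in> V \<longleftrightarrow> w < n \<and> A w w = 1" for w
    by (auto simp: V_def family_graph_def)
  have E: "(x, y) \<in> E \<longleftrightarrow> x < n \<and> y < n \<and> x \<noteq> y \<and> A x y = 1" for x y
    by (auto simp: E_def family_graph_def)
  note range = feasible_family_range[OF F]
  have "constraint_system n0 n A d \<gamma>"
    using F by (simp add: feasible_families_def)
  then have sum: "(\<Sum>v\<in>{0..<n}. A v v) \<ge> int n0"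
    and mono: "\<And>v. v < n - 1 \<Longrightarrow> A v v \<ge> A (v + 1) (v + 1)"
    and ends: "\<And>u v. u < n \<Longrightarrow> v < n \<Longrightarrow> u \<noteq> v \<Longrightarrow> 2 * A u v \<le> A u u + A v v \<and> A u v \<ge> \<gamma> u v"
    and sum0: "(\<Sum>u\<in>{0..<n}. \<gamma> u 0) = 0"
    and diag: "\<And>v. v < n \<Longrightarrow> v \<noteq> 0 \<Longrightarrow> \<gamma> v v = 0"
    and tight_in: "\<And>v. v < n \<Longrightarrow> v \<noteq> 0 \<Longrightarrow> A v v \<le> (\<Sum>u\<in>{0..<n}. \<gamma> u v)"
    and d0: "d 0 = 0"
    and d_missing: "\<And>v. v < n \<Longrightarrow> v \<noteq> 0 \<Longrightarrow> 1 + (int n - 1) * (1 - A v v) \<le> d v"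
    and levels: "\<And>u v. u < n \<Longrightarrow> v < n \<Longrightarrow> u \<noteq> v \<Longrightarrow>
        (1 - \<gamma> u v) - int n * (1 - A u v) \<le> d u + 1 - d v \<and>
        d u + 1 - d v \<le> (int n + 1) * (1 - \<gamma> u v)"
    by (simp_all add: constraint_system_def)

  have finV: "finite V" by (simp add: V_def family_graph_def)
  have "w \<in> V" if "v \<in> V" "w < v" for v w
  proof -
    have "x < n \<longrightarrow> A x x \<le> A w w" if "w \<le> x" for x
      using that
    proof (induction rule: dec_induct)
      case base
      show ?case by simp
    next
      case (step x)
      show ?case
      proof
        assume "Suc x < n"
        then show "A (Suc x) (Suc x) \<le> A w w" using step.IH mono[of x] by (simp add: less_diff_conv)
      qed
    qed
    from this[of v] have "A v v \<le> A w w" using that V by simp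
    with that range(1)[of w w] V show "w \<in> V" by auto
  qed
  with finV show segment: "V = {0..<card V}" by (rule down_closed_eq_segment)
  have "V \<subseteq> {0..<n}" by (auto simp: V)
  then show "card V \<le> n" using card_mono[of "{0..<n}" V] by simp
  have "(\<Sum>v\<in>{0..<n}. A v v) = (\<Sum>v\<in>{0..<n}. if v \<in> V then 1 else 0)"
  proof (rule sum.cong)
    fix w assume "w \<in> {0..<n}"
    then show "A w w = (if w \<in> V then 1 else 0)" using range(1)[of w w] V[of w] by auto
  qed simp
  also have "\<dots> = int (card V)"
    using \<open>V \<subseteq> {0..<n}\<close> by (simp add: sum.If_cases Int_absorb1)
  finally show card: "n0 \<le> card V" using sum by simp
  have "0 \<in> {0..<card V}" using card n0 by simp
  then have root: "0 \<in> V" using segment by simp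
  \<comment> \<open>An arc gives \<open>2 \<le> A x x + A y y\<close>, which forces both binary values to be \<open>1\<close>.\<close>
  show arcs: "E \<subseteq> V \<times> V"
  proof clarify
    fix x y assume xy: "(x, y) \<in> E"
    then have "2 \<le> A x x + A y y" using ends[of x y] E by auto
    with range(1)[of x x] range(1)[of y y] xy show "x \<in> V \<and> y \<in> V"
      by (auto simp: V E)
  qed
  have diag0: "\<gamma> 0 0 = 0"
  proof -
    have "0 < n" using root V by simp
    then show ?thesis
      using range(2)[of _ 0] sum0
      by (intro sum_nonneg_0[of "{0..<n}" "\<lambda>u. \<gamma> u 0" 0]) fastforce+
  qed
  \<comment> \<open>On an arc, \<open>\<gamma> x y = 1\<close> gives \<open>0 \<le> d x + 1 - d y \<le> 0\<close>, while \<open>\<gamma> x y = 0\<close> gives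
    \<open>1 \<le> d x + 1 - d y\<close>; between nodes not joined by an
    arc, \<open>\<gamma> \<le> A\<close> leaves only \<open>0\<close>, and so does the third constraint on the diagonal.\<close>
  have tight: "\<gamma> x y = 1 \<longleftrightarrow> (x, y) \<in> E \<and> d y = d x + 1" if xy: "x < n" "y < n" for x y
  proof (cases "x = y")
    case True
    with diag diag0 xy show ?thesis by (cases "x = 0") auto
  next
    case False
    with xy range(1,2)[of x y] ends[of x y] levels[of x y] show ?thesis by (auto simp: E)
  qed
  then show "u < n \<Longrightarrow> v < n \<Longrightarrow> \<gamma> u v = 1 \<longleftrightarrow> (u, v) \<in> E \<and> d v = d u + 1" .
  have arc: "d y \<le> d x + 1" if "(x, y) \<in> E" for x y
    using levels[of x y] range(2)[of x y] that by (auto simp: E)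
  have descent: "\<exists>x\<in>V. (x, y) \<in> E \<and> d y = d x + 1" if y: "y \<in> V" "y \<noteq> 0" for y
  proof -
    have "(\<Sum>x\<in>{0..<n}. \<gamma> x y) \<noteq> 0" using tight_in[of y] y V by auto
    then obtain x where "x < n" "\<gamma> x y \<noteq> 0" by (meson atLeastLessThan_iff sum.neutral)
    with y V range(2)[of x y] tight[of x y] arcs show ?thesis by blast
  qed
  have nonneg: "0 \<le> d y" if "y \<in> V" for y
    using range(3)[of y y] that V by simp
  show "v \<in> V \<Longrightarrow> (0, v) \<in> E\<^sup>*" "v \<in> V \<Longrightarrow> d v = int (hop_dist 0 E v)"
    using hop_dist_unique[of d 0 V E v, OF d0 nonneg arc descent] by auto
  \<comment> \<open>A missing node has \<open>A v v = 0\<close>, and then the lower bound on \<open>d v\<close> is \<open>1 + (n - 1) = n\<close>.\<close>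
  show "d v = int n" if v: "v < n" "v \<notin> V"
  proof -
    have "v \<noteq> 0" using v(2) root by metis
    moreover have "A v v = 0" using v V[of v] range(1)[of v v] by auto
    ultimately show ?thesis using d_missing[of v] range(4)[of v v] v by simp
  qed
qed

lemma family_graph_rooted:
  assumes "F \<in> feasible_families n0 n" "1 \<le> n0"
  shows "family_graph n F \<in> rooted_digraphs n0 n"
proof -
  obtain A d \<gamma> where F: "F = (A, d, \<gamma>)" by (cases F)
  note facts = assms[unfolded F]
  have "\<forall>v. (v, v) \<notin> parcs (family_graph n F)"
    by (simp add: F family_graph_def)
  with family_verts[OF facts] family_arcs[OF facts] family_reach[OF facts] show ?thesis
    unfolding F rooted_digraphs_iff by blast
qed

section \<open>From graphs to families\<close>

text \<open>The value \<open>n\<close> at missing nodes is the one that the constraints force.\<close>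

definition graph_family ::
  "nat \<Rightarrow> nat pair_pre_digraph \<Rightarrow> (nat \<Rightarrow> nat \<Rightarrow> int) \<times> (nat \<Rightarrow> int) \<times> (nat \<Rightarrow> nat \<Rightarrow> int)" where
  "graph_family n G =
     (let D = hop_dist 0 (parcs G) in
      (\<lambda>u\<in>{0..<n}. \<lambda>v\<in>{0..<n}. of_bool (if u = v then v \<in> pverts G else (u, v) \<in> parcs G),
       \<lambda>v\<in>{0..<n}. if v \<in> pverts G then int (D v) else int n,
       \<lambda>u\<in>{0..<n}. \<lambda>v\<in>{0..<n}. of_bool ((u, v) \<in> parcs G \<and> D v = D u + 1)))"

lemma graph_family_feasible:
  assumes G: "G \<in> rooted_digraphs n0 n" and n0: "1 \<le> n0"
  shows "graph_family n G \<in> feasible_families n0 n"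
proof -
  define V where "V = pverts G"
  define E where "E = parcs G"
  define D where "D = hop_dist 0 E"
  obtain m where m: "n0 \<le> m" "m \<le> n" "V = {0..<m}"
    and wf: "E \<subseteq> V \<times> V" and loopfree: "\<And>v. (v, v) \<notin> E"
    and reach: "\<And>v. v \<in> V \<Longrightarrow> (0, v) \<in> E\<^sup>*"
    using G unfolding rooted_digraphs_iff V_def E_def by blast
  have root: "0 \<in> V" using m n0 by simp
  have n: "1 \<le> n" using m n0 by simp
  have D_bound: "D v < n" if "v \<in> V" for v
    using hop_dist_less_card[OF _ root wf reach[OF that]] m by (simp add: D_def)
  have D_arc: "D v \<le> D u + 1" if "(u, v) \<in> E" for u v
    using hop_dist_arc[OF reach that] wf that by (auto simp: D_def)
  have D_root: "D 0 = 0" by (simp add: D_def)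
  have D_pred: "\<exists>u. (u, v) \<in> E \<and> D v = D u + 1" if "v \<in> V" "v \<noteq> 0" for v
    unfolding D_def by (rule hop_dist_predecessor[OF reach[OF that(1)] that(2)]) blast
  then have D_pos: "1 \<le> D v" if "v \<in> V" "v \<noteq> 0" for v
    using that by fastforce

  define A :: "nat \<Rightarrow> nat \<Rightarrow> int" where
    "A = (\<lambda>u\<in>{0..<n}. \<lambda>v\<in>{0..<n}. of_bool (if u = v then v \<in> V else (u, v) \<in> E))"
  define d where "d = (\<lambda>v\<in>{0..<n}. if v \<in> V then int (D v) else int n)"
  define \<gamma> :: "nat \<Rightarrow> nat \<Rightarrow> int" where
    "\<gamma> = (\<lambda>u\<in>{0..<n}. \<lambda>v\<in>{0..<n}. of_bool ((u, v) \<in> E \<and> D v = D u + 1))"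
  have family: "graph_family n G = (A, d, \<gamma>)"
    unfolding graph_family_def Let_def A_def d_def \<gamma>_def D_def E_def V_def ..
  have A_node: "A v v = of_bool (v \<in> V)" if "v < n" for v
    using that by (simp add: A_def)
  have A_arc: "A u v = of_bool ((u, v) \<in> E)" if "u < n" "v < n" "u \<noteq> v" for u v
    using that by (simp add: A_def)
  have \<gamma>: "\<gamma> u v = of_bool ((u, v) \<in> E \<and> D v = D u + 1)" if "u < n" "v < n" for u v
    using that by (simp add: \<gamma>_def)
  have d: "d v = (if v \<in> V then int (D v) else int n)" if "v < n" for v
    using that by (simp add: d_def)
  have d_range: "0 \<le> d v" "d v \<le> int n" if "v < n" for v
    using that D_bound[of v] by (auto simp: d)

  have sum_A: "(\<Sum>v\<in>{0..<n}. A v v) \<ge> int n0"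
  proof -
    have "(\<Sum>v\<in>{0..<n}. A v v) = (\<Sum>v\<in>{0..<n}. if v \<in> V then 1 else 0)"
      by (rule sum.cong) (auto simp: A_node)
    also have "\<dots> = int (card V)"
    proof -
      have "V \<subseteq> {0..<n}" using m by auto
      then show ?thesis by (simp add: sum.If_cases Int_absorb1)
    qed
    finally show ?thesis using m by simp
  qed
  have mono: "A (v + 1) (v + 1) \<le> A v v" if "v < n - 1" for v
    using that m(3) by (auto simp: A_node)
  have ends: "2 * A u v \<le> A u u + A v v" "\<gamma> u v \<le> A u v" if "u < n" "v < n" "u \<noteq> v" for u v
    using that wf by (auto simp: A_node A_arc \<gamma>)
  have sum_root: "(\<Sum>u\<in>{0..<n}. \<gamma> u 0) = 0"
    by (rule sum.neutral) (use n D_root in \<open>auto simp: \<gamma>\<close>)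
  have diag: "\<gamma> v v = 0" if "v < n" for v
    using that loopfree by (simp add: \<gamma>)
  have sum_lower: "A v v \<le> (\<Sum>u\<in>{0..<n}. \<gamma> u v)" if v: "v < n" "v \<noteq> 0" for v
  proof (cases "v \<in> V")
    case True
    then obtain u where u: "(u, v) \<in> E" "D v = D u + 1" using D_pred v by blast
    then have "u < n" using wf m by auto
    then have "\<gamma> u v \<le> (\<Sum>u\<in>{0..<n}. \<gamma> u v)"
      by (intro member_le_sum) (use v in \<open>auto simp: \<gamma>\<close>)
    with u \<open>u < n\<close> v True show ?thesis by (simp add: A_node \<gamma>)
  next
    case False
    have "0 \<le> (\<Sum>u\<in>{0..<n}. \<gamma> u v)"
      by (rule sum_nonneg) (use v in \<open>auto simp: \<gamma>\<close>)
    with False v show ?thesis by (simp add: A_node)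
  qed
  have sum_upper: "(\<Sum>u\<in>{0..<n}. \<gamma> u v) \<le> (int n - 1) * A v v" if v: "v < n" for v
  proof -
    \<comment> \<open>The factor \<open>n - 1\<close> counts the possible predecessors, \<open>v\<close> itself being excluded.\<close>
    have "(\<Sum>u\<in>{0..<n}. \<gamma> u v) = (\<Sum>u\<in>{0..<n} - {v}. \<gamma> u v)"
      using v diag by (simp add: sum_diff1)
    also have "\<dots> \<le> (\<Sum>u\<in>{0..<n} - {v}. A v v)"
      by (rule sum_mono) (use v wf in \<open>auto simp: \<gamma> A_node\<close>)
    also have "\<dots> = (int n - 1) * A v v"
      using v by (simp add: of_nat_diff)
    finally show ?thesis .
  qed
  have d_root: "d 0 = 0" using n root D_root by (simp add: d)
  have d_bounds: "1 + (int n - 1) * (1 - A v v) \<le> d v" "d v \<le> int n - A v v"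
    if "v < n" "v \<noteq> 0" for v
    using that D_bound[of v] D_pos[of v] by (auto simp: d A_node)
  have levels: "(1 - \<gamma> u v) - int n * (1 - A u v) \<le> d u + 1 - d v"
    "d u + 1 - d v \<le> (int n + 1) * (1 - \<gamma> u v)" if uv: "u < n" "v < n" "u \<noteq> v" for u v
  proof -
    show "(1 - \<gamma> u v) - int n * (1 - A u v) \<le> d u + 1 - d v"
    proof (cases "(u, v) \<in> E")
      case True
      with uv wf D_arc[OF True] show ?thesis by (auto simp: \<gamma> A_arc d)
    next
      case False
      with uv d_range(1)[of u] d_range(2)[of v] show ?thesis by (simp add: \<gamma> A_arc)
    qed
    show "d u + 1 - d v \<le> (int n + 1) * (1 - \<gamma> u v)"
      using uv wf d_range(2)[of u] d_range(1)[of v] by (auto simp: \<gamma> d split: if_splits)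
  qed
  have "constraint_system n0 n A d \<gamma>"
    unfolding constraint_system_def
    using sum_A mono ends sum_root diag sum_lower sum_upper d_root d_bounds levels by simp
  moreover have "A \<in> {0..<n} \<rightarrow>\<^sub>E ({0..<n} \<rightarrow>\<^sub>E {0, 1})" "\<gamma> \<in> {0..<n} \<rightarrow>\<^sub>E ({0..<n} \<rightarrow>\<^sub>E {0, 1})"
    by (auto simp: A_def \<gamma>_def)
  moreover have "d \<in> {0..<n} \<rightarrow>\<^sub>E {0..int n}"
    using d_range by (auto simp: PiE_iff) (simp add: d_def)
  ultimately show ?thesis
    by (simp add: family feasible_families_def)
qed

section \<open>The two constructions are inverse to each other\<close>

lemma family_graph_graph_family:
  assumes "G \<in> rooted_digraphs n0 n"
  shows "family_graph n (graph_family n G) = G"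
proof -
  have "pverts G \<subseteq> {0..<n}" "parcs G \<subseteq> pverts G \<times> pverts G" "\<forall>v. (v, v) \<notin> parcs G"
    using assms unfolding rooted_digraphs_iff by auto
  then have "pverts (family_graph n (graph_family n G)) = pverts G"
    and "parcs (family_graph n (graph_family n G)) = parcs G"
    by (auto simp: family_graph_def graph_family_def Let_def subset_iff split: if_splits)
  then show ?thesis by simp
qed

text \<open>Here the uniqueness of \<open>d\<close> and \<open>\<gamma>\<close> enters. Both sides are extensional, so agreement on
  indices below \<open>n\<close> suffices.\<close>

lemma graph_family_family_graph:
  assumes "F \<in> feasible_families n0 n" "1 \<le> n0"
  shows "graph_family n (family_graph n F) = F"
proof -
  obtain A d \<gamma> where F: "F = (A, d, \<gamma>)" by (cases F)
  note facts = assms[unfolded F]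
  define V where "V = pverts (family_graph n F)"
  define E where "E = parcs (family_graph n F)"
  obtain A' d' \<gamma>' where F': "graph_family n (family_graph n F) = (A', d', \<gamma>')"
    by (cases "graph_family n (family_graph n F)")
  note defs = F'[unfolded graph_family_def Let_def, folded V_def E_def]
  note range = feasible_family_range[OF facts(1)]
  have V: "v \<in> V \<longleftrightarrow> v < n \<and> A v v = 1" for v
    by (auto simp: V_def F family_graph_def)
  have E: "(u, v) \<in> E \<longleftrightarrow> u < n \<and> v < n \<and> u \<noteq> v \<and> A u v = 1" for u v
    by (auto simp: E_def F family_graph_def)
  have dist: "v \<in> V \<Longrightarrow> d v = int (hop_dist 0 E v)" for v
    using family_dist[OF facts] by (simp add: V_def E_def F)
  have ext: "A \<in> {0..<n} \<rightarrow>\<^sub>E ({0..<n} \<rightarrow>\<^sub>E {0, 1})" "d \<in> {0..<n} \<rightarrow>\<^sub>E {0..int n}"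
    "\<gamma> \<in> {0..<n} \<rightarrow>\<^sub>E ({0..<n} \<rightarrow>\<^sub>E {0, 1})"
    using facts(1) by (auto simp: feasible_families_def)
  have ext': "A' \<in> {0..<n} \<rightarrow>\<^sub>E ({0..<n} \<rightarrow>\<^sub>E {0, 1})" "d' \<in> {0..<n} \<rightarrow>\<^sub>E {0..int n}"
    "\<gamma>' \<in> {0..<n} \<rightarrow>\<^sub>E ({0..<n} \<rightarrow>\<^sub>E {0, 1})"
    using graph_family_feasible[OF family_graph_rooted[OF assms] assms(2)]
    by (auto simp: F' feasible_families_def)
  have "A' u v = A u v" if "u < n" "v < n" for u v
    using that defs range(1)[of u v] by (auto simp: V E)
  then have A: "A' = A"
    by (intro PiE_ext[OF ext'(1) ext(1)] PiE_ext[OF PiE_mem[OF ext'(1)] PiE_mem[OF ext(1)]]) auto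
  have "d' v = d v" if "v < n" for v
    using that defs dist[of v] family_dist_missing[OF facts, of v] by (auto simp: V_def F)
  then have d: "d' = d"
    by (intro PiE_ext[OF ext'(2) ext(2)]) auto
  have "\<gamma>' u v = \<gamma> u v" if uv: "u < n" "v < n" for u v
  proof -
    have "\<gamma> u v = 1 \<longleftrightarrow> (u, v) \<in> E \<and> d v = d u + 1"
      using family_tight[OF facts uv] by (simp add: E_def F)
    also have "\<dots> \<longleftrightarrow> (u, v) \<in> E \<and> hop_dist 0 E v = hop_dist 0 E u + 1"
      using family_arcs[OF facts] dist[of u] dist[of v] by (auto simp: V_def E_def F)
    finally show ?thesis
      using uv defs range(2)[of u v] by auto
  qed
  then have "\<gamma>' = \<gamma>"
    by (intro PiE_ext[OF ext'(3) ext(3)] PiE_ext[OF PiE_mem[OF ext'(3)] PiE_mem[OF ext(3)]]) auto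
  with A d show ?thesis using F F' by simp
qed

theorem theorem2:
  fixes n0 n :: nat
  assumes "1 \<le> n0" and "n0 \<le> n"
  shows "\<exists>\<phi>. bij_betw \<phi> (feasible_families n0 n) (rooted_digraphs n0 n)"
proof
  show "bij_betw (family_graph n) (feasible_families n0 n) (rooted_digraphs n0 n)"
  proof (rule bij_betw_byWitness[where f' = "graph_family n"])
    show "\<forall>F\<in>feasible_families n0 n. graph_family n (family_graph n F) = F"
      using graph_family_family_graph assms(1) by blast
    show "\<forall>G\<in>rooted_digraphs n0 n. family_graph n (graph_family n G) = G"
      using family_graph_graph_family by blast
    show "family_graph n ` feasible_families n0 n \<subseteq> rooted_digraphs n0 n"
      using family_graph_rooted assms(1) by blast
    show "graph_family n ` rooted_digraphs n0 n \<subseteq> feasible_families n0 n"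
      using graph_family_feasible assms(1) by blast
  qed
qed

end
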